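(* For any monoid $M$, the variety $(\mathcal{G}_M,\mathcal{R}_M)$ of $M$-pigmented monoids is a presentation of the clone $\mathbf{P}(M)$; that is, $\mathbf{P}(M)$ is isomorphic as a clone to $\mathbf{T}(\mathcal{G}_M)/_{\equiv_{\mathcal{R}_M}}$.
   Context: An (abstract) clone $C$ is a graded set $C=\bigsqcup_{n\ge 0}C(n)$ with superposition maps $C(n)\times C(m)^n\to C(m)$, $(x,(y_1,\dots,y_n))\mapsto x[y_1,\dots,y_n]$, and projections $\mathbf{1}_{i,n}\in C(n)$ ($n\ge1$, $i\in[n]$) such that $\mathbf{1}_{i,n}[y_1,\dots,y_n]=y_i$, $x[\mathbf{1}_{1,n},\dots,\mathbf{1}_{n,n}]=x$ for $x\in C(n)$, and $x[y_1,\dots,y_n][z_1,\dots,z_m]=x[y_1[z_1,\dots,z_m],\dots,y_n[z_1,\dots,z_m]]$. Clone morphisms preserve arities, projections and superpositions; a clone congruence is an arity-preserving equivalence relation compatible with superposition, and quotients are defined accordingly. Pigmented words: let $(M,\cdot,e)$ be a monoid. An $M$-pigmented letter is a pair written $i^\alpha$ with $i$ a positive integer (its value) and $\alpha\in M$ (its pigment). For $n\ge0$, $\mathbf{P}(M)(n)$ is the set of finite words of $M$-pigmented letters all of whose values lie in $[n]$ (the empty word is $\epsilon$). For $\alpha\in M$ and $\mathfrak{p}=i_1^{\alpha_1}\cdots i_\ell^{\alpha_\ell}$ put $\alpha\odot\mathfrak{p}:=i_1^{\alpha\cdot\alpha_1}\cdots i_\ell^{\alpha\cdot\alpha_\ell}$.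 The clone $\mathbf{P}(M)$ has superposition $i_1^{\alpha_1}\cdots i_\ell^{\alpha_\ell}[\mathfrak{p}_1,\dots,\mathfrak{p}_n]:=(\alpha_1\odot\mathfrak{p}_{i_1})\cdots(\alpha_\ell\odot\mathfrak{p}_{i_\ell})$ (concatenation) and projections $\mathbf{1}_{i,n}:=i^e$. Terms and presentations: for a signature (graded set) $\mathcal{G}$, $\mathcal{G}$-terms are variables $x_1,x_2,\dots$ or $g[t_1,\dots,t_k]$ with $g\in\mathcal{G}(k)$ and $t_j$ terms; $\mathbf{T}(\mathcal{G})(n)$ is the set of terms with all variables in $\{x_1,\dots,x_n\}$; $\mathbf{T}(\mathcal{G})$ is the free clone, with superposition $t[t_1,\dots,t_n]$ the simultaneous substitution of $t_i$ for $x_i$ and projections $x_i$. A variety is a pair $(\mathcal{G},\mathcal{R})$ with $\mathcal{R}$ an equivalence relation on $\mathbf{T}(\mathcal{G})$; $\equiv_{\mathcal{R}}$ is the smallest clone congruence of $\mathbf{T}(\mathcal{G})$ containing $\mathcal{R}$; $(\mathcal{G},\mathcal{R})$ is a presentation of a clone $C$ if $C\cong \mathbf{T}(\mathcal{G})/_{\equiv_{\mathcal{R}}}$. The variety of $M$-pigmented monoids: $\mathcal{G}_M(0)=\{\mathsf{u}\}$, $\mathcal{G}_M(1)=\{\mathsf{p}_\alpha:\alpha\in M\}$, $\mathcal{G}_M(2)=\{\star\}$, and $\mathcal{R}_M$ is the equivalence relation on $\mathbf{T}(\mathcal{G}_M)$ generated by, for all $\alpha,\alpha_1,\alpha_2\in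 M$: $\star[\star[x_1,x_2],x_3]\sim\star[x_1,\star[x_2,x_3]]$; $\star[\mathsf{u},x_1]\sim x_1\sim\star[x_1,\mathsf{u}]$; $\mathsf{p}_\alpha[\star[x_1,x_2]]\sim\star[\mathsf{p}_\alpha[x_1],\mathsf{p}_\alpha[x_2]]$; $\mathsf{p}_\alpha[\mathsf{u}]\sim\mathsf{u}$; $\mathsf{p}_{\alpha_1}[\mathsf{p}_{\alpha_2}[x_1]]\sim\mathsf{p}_{\alpha_1\cdot\alpha_2}[x_1]$; $\mathsf{p}_e[x_1]\sim x_1$. *)

theory Defs
  imports "HOL-Algebra.Group"
begin

section \<open>Abstract clones\<close>

text \<open>
  A graded set \<open>\<Squnion>n. C n\<close> is given by its family of components. The components need not be
  disjoint as subsets of the ambient type (a word over \<open>[n]\<close> is also a word over \<open>[n + 1]\<close>), so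
  every operation receives the relevant arities explicitly: \<open>superpose C n m\<close> is the map
  \<open>C(n) \<times> C(m)^n \<rightarrow> C(m)\<close>, with tuples represented as lists, and \<open>proj C i n\<close> is the
  \<open>i\<close>-th projection in \<open>C(n)\<close>. The target arity \<open>m\<close> matters in particular when \<open>n = 0\<close>.
\<close>

record 'a clone_struct =
  ops :: "nat \<Rightarrow> 'a set"
  superpose :: "nat \<Rightarrow> nat \<Rightarrow> 'a \<Rightarrow> 'a list \<Rightarrow> 'a"
  proj :: "nat \<Rightarrow> nat \<Rightarrow> 'a"

definition tuples :: "nat \<Rightarrow> 'a set \<Rightarrow> 'a list set"
  where "tuples n A = {xs. length xs = n \<and> set xs \<subseteq> A}"

locale clone =
  fixes C :: "'a clone_struct"
  assumes superpose_closed: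
      "x \<in> ops C n \<Longrightarrow> ys \<in> tuples n (ops C m) \<Longrightarrow> superpose C n m x ys \<in> ops C m"
    and proj_closed: "i \<in> {1..n} \<Longrightarrow> proj C i n \<in> ops C n"
    and proj_superpose:
      "i \<in> {1..n} \<Longrightarrow> ys \<in> tuples n (ops C m) \<Longrightarrow>
         superpose C n m (proj C i n) ys = ys ! (i - 1)"
    and superpose_projs:
      "x \<in> ops C n \<Longrightarrow> superpose C n n x (map (\<lambda>i. proj C i n) [1..<Suc n]) = x"
    and superpose_assoc:
      "x \<in> ops C n \<Longrightarrow> ys \<in> tuples n (ops C m) \<Longrightarrow> zs \<in> tuples m (ops C k) \<Longrightarrow>
         superpose C m k (superpose C n m x ys) zs =
         superpose C n k x (map (\<lambda>y. superpose C m k y zs) ys)"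

locale clone_morphism = C: clone C + D: clone D
  for C :: "'a clone_struct" and D :: "'b clone_struct" +
  fixes f :: "nat \<Rightarrow> 'a \<Rightarrow> 'b"
  assumes morphism_closed: "x \<in> ops C n \<Longrightarrow> f n x \<in> ops D n"
    and morphism_proj: "i \<in> {1..n} \<Longrightarrow> f n (proj C i n) = proj D i n"
    and morphism_superpose:
      "x \<in> ops C n \<Longrightarrow> ys \<in> tuples n (ops C m) \<Longrightarrow>
         f m (superpose C n m x ys) = superpose D n m (f n x) (map (f m) ys)"

definition clone_isomorphism ::
    "'a clone_struct \<Rightarrow> 'b clone_struct \<Rightarrow> (nat \<Rightarrow> 'a \<Rightarrow> 'b) \<Rightarrow> bool"
  where "clone_isomorphism C D f \<longleftrightarrow>
    clone_morphism C D f \<and> (\<forall>n. bij_betw (f n) (ops C n) (ops D n))"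

definition clones_isomorphic :: "'a clone_struct \<Rightarrow> 'b clone_struct \<Rightarrow> bool"
  where "clones_isomorphic C D \<longleftrightarrow> (\<exists>f. clone_isomorphism C D f)"

text \<open>An arity-preserving relation is given by its restrictions to the components.\<close>

definition clone_congruence :: "'a clone_struct \<Rightarrow> (nat \<Rightarrow> 'a rel) \<Rightarrow> bool"
  where "clone_congruence C E \<longleftrightarrow>
    (\<forall>n. equiv (ops C n) (E n)) \<and>
    (\<forall>n m x x' ys ys'. (x, x') \<in> E n \<longrightarrow> length ys = n \<longrightarrow>
       list_all2 (\<lambda>y y'. (y, y') \<in> E m) ys ys' \<longrightarrow>
       (superpose C n m x ys, superpose C n m x' ys') \<in> E m)"

definition generated_congruence :: "'a clone_struct \<Rightarrow> (nat \<Rightarrow> 'a rel) \<Rightarrow> nat \<Rightarrow> 'a rel"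
  where "generated_congruence C R n =
    \<Inter> {E n |E. clone_congruence C E \<and> (\<forall>k. R k \<subseteq> E k)}"

definition quotient_clone :: "'a clone_struct \<Rightarrow> (nat \<Rightarrow> 'a rel) \<Rightarrow> 'a set clone_struct"
  where "quotient_clone C E =
    \<lparr>ops = (\<lambda>n. ops C n // E n),
     superpose = (\<lambda>n m X Ys. \<Union>x\<in>X. \<Union>ys\<in>listset Ys. E m `` {superpose C n m x ys}),
     proj = (\<lambda>i n. E n `` {proj C i n})\<rparr>"


section \<open>Terms, varieties and presentations\<close>

datatype 'g trm = Var nat | Op 'g "'g trm list"

text \<open>A signature is a graded set \<open>G\<close>; the variables are \<open>Var 1, Var 2, \<dots>\<close>.\<close>

inductive_set terms :: "(nat \<Rightarrow> 'g set) \<Rightarrow> 'g trm set" for G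
  where
    Var: "1 \<le> i \<Longrightarrow> Var i \<in> terms G"
  | Op: "g \<in> G (length ts) \<Longrightarrow> (\<forall>t\<in>set ts. t \<in> terms G) \<Longrightarrow> Op g ts \<in> terms G"

primrec vars :: "'g trm \<Rightarrow> nat set"
  where
    "vars (Var i) = {i}"
  | "vars (Op g ts) = \<Union> (set (map vars ts))"

primrec subst :: "'g trm list \<Rightarrow> 'g trm \<Rightarrow> 'g trm"
  where
    "subst us (Var i) = us ! (i - 1)"
  | "subst us (Op g ts) = Op g (map (subst us) ts)"

definition term_clone :: "(nat \<Rightarrow> 'g set) \<Rightarrow> 'g trm clone_struct"
  where "term_clone G =
    \<lparr>ops = (\<lambda>n. {t \<in> terms G. vars t \<subseteq> {1..n}}),
     superpose = (\<lambda>n m t us. subst us t),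
     proj = (\<lambda>i n. Var i)\<rparr>"

definition variety :: "(nat \<Rightarrow> 'g set) \<Rightarrow> (nat \<Rightarrow> 'g trm rel) \<Rightarrow> bool"
  where "variety G R \<longleftrightarrow> (\<forall>n. equiv (ops (term_clone G) n) (R n))"

definition is_presentation ::
    "(nat \<Rightarrow> 'g set) \<Rightarrow> (nat \<Rightarrow> 'g trm rel) \<Rightarrow> 'a clone_struct \<Rightarrow> bool"
  where "is_presentation G R C \<longleftrightarrow>
    variety G R \<and>
    clones_isomorphic C
      (quotient_clone (term_clone G) (generated_congruence (term_clone G) R))"

definition generated_equiv :: "'a set \<Rightarrow> 'a rel \<Rightarrow> 'a rel"
  where "generated_equiv A r = \<Inter> {E. equiv A E \<and> r \<subseteq> E}"


section \<open>The clone of pigmented words\<close>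

text \<open>The letter of value \<open>i\<close> and pigment \<open>\<alpha>\<close> is the pair \<open>(i, \<alpha>)\<close>.\<close>

type_synonym 'm pword = "(nat \<times> 'm) list"

definition pigment_act :: "('m, 'b) monoid_scheme \<Rightarrow> 'm \<Rightarrow> 'm pword \<Rightarrow> 'm pword"
  where "pigment_act M \<alpha> w = map (\<lambda>(i, \<beta>). (i, \<alpha> \<otimes>\<^bsub>M\<^esub> \<beta>)) w"

definition pigmented_clone :: "('m, 'b) monoid_scheme \<Rightarrow> 'm pword clone_struct"
  where "pigmented_clone M =
    \<lparr>ops = (\<lambda>n. {w. set w \<subseteq> {1..n} \<times> carrier M}),
     superpose = (\<lambda>n m w ps. concat (map (\<lambda>(i, \<alpha>). pigment_act M \<alpha> (ps ! (i - 1))) w)),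
     proj = (\<lambda>i n. [(i, \<one>\<^bsub>M\<^esub>)])\<rparr>"


section \<open>The variety of pigmented monoids\<close>

datatype 'm pig_op = U | P 'm | Star

definition pig_sig :: "('m, 'b) monoid_scheme \<Rightarrow> nat \<Rightarrow> 'm pig_op set"
  where "pig_sig M k =
    (if k = 0 then {U}
     else if k = 1 then P ` carrier M
     else if k = 2 then {Star}
     else {})"

inductive_set pig_axioms :: "('m, 'b) monoid_scheme \<Rightarrow> 'm pig_op trm rel" for M
  where
    "(Op Star [Op Star [Var 1, Var 2], Var 3], Op Star [Var 1, Op Star [Var 2, Var 3]])
       \<in> pig_axioms M"
  | "(Op Star [Op U [], Var 1], Var 1) \<in> pig_axioms M"
  | "(Var 1, Op Star [Var 1, Op U []]) \<in> pig_axioms M"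
  | "\<alpha> \<in> carrier M \<Longrightarrow>
       (Op (P \<alpha>) [Op Star [Var 1, Var 2]], Op Star [Op (P \<alpha>) [Var 1], Op (P \<alpha>) [Var 2]])
       \<in> pig_axioms M"
  | "\<alpha> \<in> carrier M \<Longrightarrow> (Op (P \<alpha>) [Op U []], Op U []) \<in> pig_axioms M"
  | "\<alpha>\<^sub>1 \<in> carrier M \<Longrightarrow> \<alpha>\<^sub>2 \<in> carrier M \<Longrightarrow>
       (Op (P \<alpha>\<^sub>1) [Op (P \<alpha>\<^sub>2) [Var 1]], Op (P (\<alpha>\<^sub>1 \<otimes>\<^bsub>M\<^esub> \<alpha>\<^sub>2)) [Var 1]) \<in> pig_axioms M"
  | "(Op (P \<one>\<^bsub>M\<^esub>) [Var 1], Var 1) \<in> pig_axioms M"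

text \<open>
  An equation holds in arity \<open>n\<close> as soon as both of its sides are terms of arity \<open>n\<close>. Imposing it
  in the least such arity only would generate the same clone congruence.
\<close>

definition pig_rel :: "('m, 'b) monoid_scheme \<Rightarrow> nat \<Rightarrow> 'm pig_op trm rel"
  where "pig_rel M n =
    (let T = ops (term_clone (pig_sig M)) n in generated_equiv T (pig_axioms M \<inter> T \<times> T))"

end

theory Submission
  imports Defs
begin

text \<open>
  Evaluation of terms is a surjective clone morphism onto the pigmented words that respects the
  axioms, so the clone of words is the quotient of the term clone by its kernel. The kernel is the
  generated congruence: modulo the axioms, every term is equal to the right-nested product of
  letters \<open>P \<alpha> [Var i]\<close> spelling out its value, so terms with the same value are congruent.
\<close>

section \<open>Kernels and quotients of clones\<close>

lemma in_listset_iff: "xs \<in> listset As \<longleftrightarrow> list_all2 (\<in>) xs As"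
  by (induction As arbitrary: xs) (auto simp: set_Cons_def list_all2_Cons2)

text \<open>Choosing a representative of each entry, by induction on the list, reduces statements
  about tuples of classes to tuples of elements.\<close>

lemma tuples_quotient_lift:
  assumes "Xs \<in> tuples n (A // r)"
  obtains xs where "xs \<in> tuples n A" and "Xs = map (\<lambda>x. r `` {x}) xs"
proof -
  have "\<exists>xs\<in>tuples n A. Xs = map (\<lambda>x. r `` {x}) xs"
    using assms
  proof (induction Xs arbitrary: n)
    case Nil
    then show ?case by (auto simp: tuples_def)
  next
    case (Cons X Xs)
    then obtain k where n: "n = Suc k" and "Xs \<in> tuples k (A // r)" and X: "X \<in> A // r"
      by (auto simp: tuples_def)
    then obtain xs where xs: "xs \<in> tuples k A" "Xs = map (\<lambda>x. r `` {x}) xs"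
      using Cons.IH by blast
    from X obtain x where "x \<in> A" "X = r `` {x}"
      by (auto elim: quotientE)
    with xs n have "x # xs \<in> tuples n A" "X # Xs = map (\<lambda>x. r `` {x}) (x # xs)"
      by (auto simp: tuples_def)
    then show ?case by (metis (no_types))
  qed
  then show ?thesis using that by blast
qed

lemma map_in_tuples:
  assumes "xs \<in> tuples n A" and "\<And>x. x \<in> A \<Longrightarrow> f x \<in> B"
  shows "map f xs \<in> tuples n B"
  using assms by (auto simp: tuples_def)

text \<open>Compatibility of \<open>E\<close> with superposition makes every set in the defining
  union the same class, and reflexivity keeps the union from being empty.\<close>

lemma superpose_quotient_clone:
  assumes E: "clone_congruence C E"
    and x: "x \<in> ops C n" and ys: "ys \<in> tuples n (ops C m)"
  shows "superpose (quotient_clone C E) n m (E n `` {x}) (map (\<lambda>y. E m `` {y}) ys) =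
    E m `` {superpose C n m x ys}"
proof -
  have eq: "\<And>k. equiv (ops C k) (E k)"
    using E by (simp add: clone_congruence_def)
  have len: "length ys = n" and sub: "set ys \<subseteq> ops C m"
    using ys by (auto simp: tuples_def)
  have ys_iff: "ys' \<in> listset (map (\<lambda>y. E m `` {y}) ys) \<longleftrightarrow>
      list_all2 (\<lambda>y y'. (y, y') \<in> E m) ys ys'" for ys'
    by (auto simp: in_listset_iff list_all2_conv_all_nth)
  have refl: "x \<in> E n `` {x}" "ys \<in> listset (map (\<lambda>y. E m `` {y}) ys)"
    using x sub eq unfolding ys_iff
    by (auto simp: equiv_def refl_on_def list_all2_conv_all_nth subset_iff)
  have "E m `` {superpose C n m x' ys'} = E m `` {superpose C n m x ys}"
    if "x' \<in> E n `` {x}" "ys' \<in> listset (map (\<lambda>y. E m `` {y}) ys)" for x' ys'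
  proof -
    have "(superpose C n m x ys, superpose C n m x' ys') \<in> E m"
      using E that len unfolding clone_congruence_def ys_iff by blast
    then show ?thesis
      using equiv_class_eq[OF eq] by blast
  qed
  then have "(\<Union>x'\<in>E n `` {x}. \<Union>ys'\<in>listset (map (\<lambda>y. E m `` {y}) ys).
      E m `` {superpose C n m x' ys'}) = E m `` {superpose C n m x ys}"
    using refl by blast
  then show ?thesis
    by (simp add: quotient_clone_def)
qed

text \<open>Each clone law is inherited from \<open>C\<close>: pick representatives of all
  arguments, compute with them, and pass back to classes.\<close>

lemma clone_quotient_clone:
  assumes "clone C" and E: "clone_congruence C E"
  shows "clone (quotient_clone C E)"
proof -
  interpret clone C by fact
  let ?Q = "quotient_clone C E"
  note sup = superpose_quotient_clone[OF E]
  have ops: "ops ?Q n = ops C n // E n" and proj: "proj ?Q i n = E n `` {proj C i n}" for i n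
    by (simp_all add: quotient_clone_def)
  show ?thesis
  proof
    fix X n Ys m
    assume "X \<in> ops ?Q n" "Ys \<in> tuples n (ops ?Q m)"
    then obtain x ys where "x \<in> ops C n" "ys \<in> tuples n (ops C m)"
      "X = E n `` {x}" "Ys = map (\<lambda>y. E m `` {y}) ys"
      unfolding ops by (metis quotientE tuples_quotient_lift)
    then show "superpose ?Q n m X Ys \<in> ops ?Q m"
      by (simp add: sup ops quotientI superpose_closed)
  next
    fix i n :: nat
    assume "i \<in> {1..n}"
    then show "proj ?Q i n \<in> ops ?Q n"
      unfolding proj ops by (intro quotientI proj_closed)
  next
    fix i n m :: nat and Ys
    assume i: "i \<in> {1..n}" and "Ys \<in> tuples n (ops ?Q m)"
    then obtain ys where "ys \<in> tuples n (ops C m)" "Ys = map (\<lambda>y. E m `` {y}) ys"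
      unfolding ops by (metis tuples_quotient_lift)
    with i show "superpose ?Q n m (proj ?Q i n) Ys = Ys ! (i - 1)"
      by (auto simp: proj sup[OF proj_closed] proj_superpose tuples_def)
  next
    fix X n
    assume "X \<in> ops ?Q n"
    then obtain x where x: "x \<in> ops C n" "X = E n `` {x}"
      unfolding ops by (metis quotientE)
    let ?ps = "map (\<lambda>i. proj C i n) [1..<Suc n]"
    have "?ps \<in> tuples n (ops C n)"
      using proj_closed by (auto simp: tuples_def)
    moreover have "map (\<lambda>i. proj ?Q i n) [1..<Suc n] = map (\<lambda>y. E n `` {y}) ?ps"
      by (simp add: proj)
    ultimately show "superpose ?Q n n X (map (\<lambda>i. proj ?Q i n) [1..<Suc n]) = X"
      using sup[OF x(1)] superpose_projs[OF x(1)] x(2) by metis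
  next
    fix X n Ys m Zs k
    assume "X \<in> ops ?Q n" "Ys \<in> tuples n (ops ?Q m)" "Zs \<in> tuples m (ops ?Q k)"
    then obtain x ys zs where x: "x \<in> ops C n" "X = E n `` {x}"
      and ys: "ys \<in> tuples n (ops C m)" "Ys = map (\<lambda>y. E m `` {y}) ys"
      and zs: "zs \<in> tuples m (ops C k)" "Zs = map (\<lambda>y. E k `` {y}) zs"
      unfolding ops by (metis quotientE tuples_quotient_lift)
    let ?yz = "map (\<lambda>y. superpose C m k y zs) ys"
    have yz: "?yz \<in> tuples n (ops C k)"
      using ys(1) zs(1) by (auto intro: map_in_tuples superpose_closed)
    have "map (\<lambda>Y. superpose ?Q m k Y Zs) Ys = map (\<lambda>y. E k `` {y}) ?yz"
      using ys zs by (auto simp: sup tuples_def)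
    moreover have "superpose C n m x ys \<in> ops C m"
      using x ys by (simp add: superpose_closed)
    ultimately show "superpose ?Q m k (superpose ?Q n m X Ys) Zs =
        superpose ?Q n k X (map (\<lambda>Y. superpose ?Q m k Y Zs) Ys)"
      \<comment> \<open>Fusing the two nested maps would hide the form \<open>map\<close> of classes
        over \<open>?yz\<close> that \<open>sup\<close> has to match.\<close>
      using x ys zs yz by (simp add: sup superpose_assoc del: map_map)
  qed
qed

section \<open>Kernel congruence and first isomorphism theorem\<close>

definition clone_kernel :: "'a clone_struct \<Rightarrow> (nat \<Rightarrow> 'a \<Rightarrow> 'b) \<Rightarrow> nat \<Rightarrow> 'a rel"
  where "clone_kernel C h n = {(x, y). x \<in> ops C n \<and> y \<in> ops C n \<and> h n x = h n y}"

context clone_morphism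
begin

text \<open>A morphism turns a superposition in \<open>C\<close> into one in \<open>D\<close>, which
  depends only on the images of its arguments.\<close>

lemma clone_congruence_kernel: "clone_congruence C (clone_kernel C f)"
  unfolding clone_congruence_def
proof (intro conjI allI impI)
  fix n
  show "equiv (ops C n) (clone_kernel C f n)"
    by (auto simp: equiv_def refl_on_def sym_def trans_def clone_kernel_def)
next
  fix n m x x' ys ys'
  assume x: "(x, x') \<in> clone_kernel C f n" and n: "length ys = n"
    and ys: "list_all2 (\<lambda>y y'. (y, y') \<in> clone_kernel C f m) ys ys'"
  have "ys \<in> tuples n (ops C m)" "ys' \<in> tuples n (ops C m)" "map (f m) ys = map (f m) ys'"
    using n ys
    by (auto simp: tuples_def clone_kernel_def list_all2_conv_all_nth in_set_conv_nth
        intro: nth_equalityI)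
  with x show "(superpose C n m x ys, superpose C n m x' ys') \<in> clone_kernel C f m"
    by (simp add: clone_kernel_def C.superpose_closed morphism_superpose)
qed

text \<open>The inverse of the usual induced map is used: an element of \<open>D\<close> goes to its
  fibre, which by surjectivity is a kernel class. Working with fibres avoids choosing
  representatives.\<close>

theorem first_isomorphism:
  assumes surj: "\<And>n. f n ` ops C n = ops D n"
  shows "clones_isomorphic D (quotient_clone C (clone_kernel C f))"
proof -
  let ?K = "clone_kernel C f"
  let ?Q = "quotient_clone C ?K"
  define g where "g n y = {x \<in> ops C n. f n x = y}" for n y
  have g: "g n (f n x) = ?K n `` {x}" if "x \<in> ops C n" for n x
    using that by (auto simp: g_def clone_kernel_def)
  interpret Q: clone ?Q
    using C.clone_axioms clone_congruence_kernel by (rule clone_quotient_clone)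
  have "clone_morphism D ?Q g"
  proof
    fix y n
    assume "y \<in> ops D n"
    then obtain x where "x \<in> ops C n" "y = f n x"
      using surj by blast
    then show "g n y \<in> ops ?Q n"
      by (simp add: g quotient_clone_def quotientI)
  next
    fix i n :: nat
    assume "i \<in> {1..n}"
    then show "g n (proj D i n) = proj ?Q i n"
      using g[of "proj C i n" n] by (simp add: C.proj_closed morphism_proj quotient_clone_def)
  next
    fix y n zs m
    assume "y \<in> ops D n" and zs: "zs \<in> tuples n (ops D m)"
    then obtain x where x: "x \<in> ops C n" "y = f n x"
      using surj by blast
    \<comment> \<open>Surjectivity on elements lifts to lists, which gives a preimage of the whole
      tuple at once.\<close>
    have "zs \<in> map (f m) ` lists (ops C m)"
      using zs by (auto simp: lists_image[symmetric] surj tuples_def)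
    then obtain xs where "xs \<in> lists (ops C m)" and zs_eq: "zs = map (f m) xs"
      by blast
    with zs have xs: "xs \<in> tuples n (ops C m)" "zs = map (f m) xs"
      by (auto simp: tuples_def)
    have "map (g m) zs = map (\<lambda>x. ?K m `` {x}) xs"
      using xs by (auto simp: g tuples_def)
    moreover have "superpose D n m y zs = f m (superpose C n m x xs)"
      using x xs by (simp add: morphism_superpose)
    ultimately show "g m (superpose D n m y zs) = superpose ?Q n m (g n y) (map (g m) zs)"
      using x(2) g[OF x(1)] g[OF C.superpose_closed[OF x(1) xs(1)]]
        superpose_quotient_clone[OF clone_congruence_kernel x(1) xs(1)] by metis
  qed
  moreover have "bij_betw (g n) (ops D n) (ops ?Q n)" for n
  proof (rule bij_betw_imageI)
    show "inj_on (g n) (ops D n)"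
      \<comment> \<open>Fibres over points of the image are nonempty, so a fibre determines the
        point below it.\<close>
      unfolding surj[symmetric] by (rule inj_onI) (auto simp: g_def set_eq_iff)
    show "g n ` ops D n = ops ?Q n"
      unfolding surj[symmetric] by (auto simp: g quotient_clone_def quotient_def image_iff)
  qed
  ultimately show ?thesis
    unfolding clones_isomorphic_def clone_isomorphism_def by blast
qed

end

text \<open>The kernel is itself one of the congruences being intersected, which gives one
  inclusion. For the other, two elements with the same image share the normal form \<open>nf\<close>
  of that image, so every congruence containing \<open>R\<close> relates them through it.\<close>

lemma kernel_eq_generated_congruence:
  assumes "clone_morphism C D f"
    and R: "\<And>n. R n \<subseteq> clone_kernel C f n"
    and normal: "\<And>E n x. clone_congruence C E \<Longrightarrow> (\<And>k. R k \<subseteq> E k) \<Longrightarrow> x \<in> ops C n \<Longrightarrow>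
      (x, nf (f n x)) \<in> E n"
  shows "generated_congruence C R = clone_kernel C f"
proof (rule ext, rule subset_antisym)
  fix n
  show "generated_congruence C R n \<subseteq> clone_kernel C f n"
    using clone_morphism.clone_congruence_kernel[OF assms(1)] R
    by (auto simp: generated_congruence_def)
  show "clone_kernel C f n \<subseteq> generated_congruence C R n"
  proof (clarsimp simp: generated_congruence_def clone_kernel_def)
    fix x y E
    assume xy: "x \<in> ops C n" "y \<in> ops C n" "f n x = f n y"
      and E: "clone_congruence C E" "\<forall>k. R k \<subseteq> E k"
    have "(x, nf (f n x)) \<in> E n" "(y, nf (f n y)) \<in> E n"
      using normal E xy by blast+
    moreover have "equiv (ops C n) (E n)"
      using E by (simp add: clone_congruence_def)
    ultimately show "(x, y) \<in> E n"
      using xy(3) by (metis equivE symE transE)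
  qed
qed

section \<open>Generated equivalence relations\<close>

lemma generated_equiv_least:
  "equiv A E \<Longrightarrow> r \<subseteq> E \<Longrightarrow> generated_equiv A r \<subseteq> E"
  by (auto simp: generated_equiv_def)

lemma subset_generated_equiv: "r \<subseteq> generated_equiv A r"
  by (auto simp: generated_equiv_def)

text \<open>The hypothesis puts the full relation on \<open>A\<close> among the relations
  intersected, so the intersection stays inside \<open>A \<times> A\<close>.\<close>

lemma equiv_generated_equiv:
  assumes "r \<subseteq> A \<times> A"
  shows "equiv A (generated_equiv A r)"
proof -
  have "equiv A (A \<times> A)"
    by (auto simp: equiv_def refl_on_def sym_def trans_def)
  then have "generated_equiv A r \<subseteq> A \<times> A"
    using assms by (rule generated_equiv_least)
  then show ?thesis
  proof (rule equivI)
    show "refl_on A (generated_equiv A r)"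
      by (auto simp: generated_equiv_def refl_on_def equiv_def)
    show "sym (generated_equiv A r)"
      unfolding generated_equiv_def by (rule symI) (blast elim: equivE dest: symD)
    show "trans (generated_equiv A r)"
      unfolding generated_equiv_def by (rule transI) (blast elim: equivE dest: transD)
  qed
qed


section \<open>The term clone\<close>

lemma terms_Op_iff [simp]:
  "Op g ts \<in> terms G \<longleftrightarrow> g \<in> G (length ts) \<and> (\<forall>t\<in>set ts. t \<in> terms G)"
  by (auto elim: terms.cases intro: terms.Op)

lemma terms_Var_iff [simp]: "Var i \<in> terms G \<longleftrightarrow> 1 \<le> i"
  by (auto elim: terms.cases intro: terms.Var)

lemma Var_in_ops_term_clone [simp]: "Var i \<in> ops (term_clone G) n \<longleftrightarrow> i \<in> {1..n}"
  by (auto simp: term_clone_def)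

lemma Op_in_ops_term_clone [simp]:
  "Op g ts \<in> ops (term_clone G) n \<longleftrightarrow>
    g \<in> G (length ts) \<and> set ts \<subseteq> ops (term_clone G) n"
  by (auto simp: term_clone_def)

lemma superpose_term_clone [simp]: "superpose (term_clone G) n m t us = subst us t"
  and proj_term_clone [simp]: "proj (term_clone G) i n = Var i"
  by (simp_all add: term_clone_def)

text \<open>Substitution passes through \<open>Op\<close>, so closure, the unit law and
  associativity follow by structural induction from the case of a variable.\<close>

lemma clone_term_clone: "clone (term_clone G)"
proof
  fix x n ys m
  assume "x \<in> ops (term_clone G) n" "ys \<in> tuples n (ops (term_clone G) m)"
  then show "superpose (term_clone G) n m x ys \<in> ops (term_clone G) m"
    by (induction x) (auto simp: tuples_def subset_iff)
next
  fix x n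
  assume "x \<in> ops (term_clone G) n"
  then show "superpose (term_clone G) n n x (map (\<lambda>i. proj (term_clone G) i n) [1..<Suc n]) = x"
    by (induction x) (auto simp del: upt_Suc intro!: map_idI)
next
  fix x n ys m zs k
  assume "x \<in> ops (term_clone G) n" "ys \<in> tuples n (ops (term_clone G) m)"
  then show "superpose (term_clone G) m k (superpose (term_clone G) n m x ys) zs =
      superpose (term_clone G) n k x (map (\<lambda>y. superpose (term_clone G) m k y zs) ys)"
    by (induction x) (auto simp: tuples_def)
qed (auto simp: tuples_def)

text \<open>Congruences are defined through superposition only. Applying a symbol to arguments is
  the superposition of the generic term \<open>?t\<close> with them, so compatibility with symbols
  follows.\<close>

lemma congruence_Op:
  assumes E: "clone_congruence (term_clone G) E" and g: "g \<in> G (length ts)"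
    and ts: "list_all2 (\<lambda>t t'. (t, t') \<in> E n) ts ts'"
  shows "(Op g ts, Op g ts') \<in> E n"
proof -
  let ?t = "Op g (map Var [1..<Suc (length ts)])"
  have len: "length ts' = length ts"
    using ts by (simp add: list_all2_lengthD)
  have "?t \<in> ops (term_clone G) (length ts)"
    using g by (auto simp del: upt_Suc)
  then have "(?t, ?t) \<in> E (length ts)"
    using E by (auto simp: clone_congruence_def equiv_def refl_on_def)
  then have "(subst ts ?t, subst ts' ?t) \<in> E n"
    using E ts unfolding clone_congruence_def by (metis superpose_term_clone)
  moreover have "subst us ?t = Op g us" if "length us = length ts" for us
    using that by (auto simp del: upt_Suc intro!: nth_equalityI)
  ultimately show ?thesis
    using len by simp
qed

text \<open>Compatibility with superposition, taken with the same reflexively related tuple on both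
  sides. It carries an equation from arity \<open>k\<close> to its instances in arity
  \<open>n\<close>.\<close>

lemma congruence_subst:
  assumes E: "clone_congruence (term_clone G) E" and "(s, t) \<in> E k"
    and "us \<in> tuples k (ops (term_clone G) n)"
  shows "(subst us s, subst us t) \<in> E n"
proof -
  have "list_all2 (\<lambda>u u'. (u, u') \<in> E n) us us"
    using assms(1,3)
    by (auto simp: clone_congruence_def equiv_def refl_on_def tuples_def list_all2_same)
  then show ?thesis
    using assms unfolding clone_congruence_def tuples_def
    by (metis (mono_tags, lifting) mem_Collect_eq superpose_term_clone)
qed


section \<open>The clone of pigmented words\<close>

lemma in_ops_pigmented_clone [simp]:
  "w \<in> ops (pigmented_clone M) n \<longleftrightarrow> set w \<subseteq> {1..n} \<times> carrier M"
  by (simp add: pigmented_clone_def)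

lemma proj_pigmented_clone [simp]: "proj (pigmented_clone M) i n = [(i, \<one>\<^bsub>M\<^esub>)]"
  by (simp add: pigmented_clone_def)

lemma superpose_pigmented_clone [simp]:
  "superpose (pigmented_clone M) n m [] ps = []"
  "superpose (pigmented_clone M) n m ((i, \<alpha>) # w) ps =
    pigment_act M \<alpha> (ps ! (i - 1)) @ superpose (pigmented_clone M) n m w ps"
  "superpose (pigmented_clone M) n m (v @ w) ps =
    superpose (pigmented_clone M) n m v ps @ superpose (pigmented_clone M) n m w ps"
  by (simp_all add: pigmented_clone_def)

lemma pigment_act_simps [simp]:
  "pigment_act M \<alpha> [] = []"
  "pigment_act M \<alpha> ((i, \<beta>) # w) = (i, \<alpha> \<otimes>\<^bsub>M\<^esub> \<beta>) # pigment_act M \<alpha> w"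
  "pigment_act M \<alpha> (v @ w) = pigment_act M \<alpha> v @ pigment_act M \<alpha> w"
  by (simp_all add: pigment_act_def)

context monoid
begin

lemma pigment_act_closed:
  "\<alpha> \<in> carrier G \<Longrightarrow> w \<in> ops (pigmented_clone G) n \<Longrightarrow>
    pigment_act G \<alpha> w \<in> ops (pigmented_clone G) n"
  by (auto simp: pigment_act_def)

lemma pigment_act_one: "w \<in> ops (pigmented_clone G) n \<Longrightarrow> pigment_act G \<one> w = w"
  by (induction w) auto

lemma pigment_act_act:
  "\<alpha> \<in> carrier G \<Longrightarrow> \<beta> \<in> carrier G \<Longrightarrow> w \<in> ops (pigmented_clone G) n \<Longrightarrow>
    pigment_act G \<alpha> (pigment_act G \<beta> w) = pigment_act G (\<alpha> \<otimes> \<beta>) w"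
  by (induction w) (auto simp: m_assoc)

lemma nth_tuple_pigmented:
  "ps \<in> tuples n (ops (pigmented_clone G) m) \<Longrightarrow> i \<in> {1..n} \<Longrightarrow>
    ps ! (i - 1) \<in> ops (pigmented_clone G) m"
  by (auto simp: tuples_def simp del: in_ops_pigmented_clone)

text \<open>On a single letter this is the action law \<open>pigment_act_act\<close>; the action
  distributes over concatenation, so induction on the word does the rest. It is the core of
  associativity in the clone of words.\<close>

lemma superpose_pigment_act:
  assumes "\<alpha> \<in> carrier G" "w \<in> ops (pigmented_clone G) n"
    and "ps \<in> tuples n (ops (pigmented_clone G) m)"
  shows "superpose (pigmented_clone G) n m (pigment_act G \<alpha> w) ps =
    pigment_act G \<alpha> (superpose (pigmented_clone G) n m w ps)"
  using assms(2)
proof (induction w)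
  case (Cons l w)
  obtain i \<beta> where l: "l = (i, \<beta>)"
    by (cases l)
  then show ?case
    using Cons pigment_act_act[OF assms(1) _ nth_tuple_pigmented[OF assms(3)], of \<beta> i] by auto
qed simp

text \<open>The law for projections uses that the unit pigment acts trivially, the law for
  superposing projections uses the right unit of the monoid. Associativity goes letter by letter
  through the outer word.\<close>

lemma clone_pigmented_clone: "clone (pigmented_clone G)"
proof
  show closed: "superpose (pigmented_clone G) n m w ps \<in> ops (pigmented_clone G) m"
    if "w \<in> ops (pigmented_clone G) n" "ps \<in> tuples n (ops (pigmented_clone G) m)" for w n ps m
    using that(1)
  proof (induction w)
    case (Cons l w)
    obtain i \<alpha> where l: "l = (i, \<alpha>)"
      by (cases l)
    then show ?case
      using Cons pigment_act_closed[OF _ nth_tuple_pigmented[OF that(2)], of \<alpha> i] by auto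
  qed simp
  show "superpose (pigmented_clone G) n m (proj (pigmented_clone G) i n) ps = ps ! (i - 1)"
    if "i \<in> {1..n}" "ps \<in> tuples n (ops (pigmented_clone G) m)" for i n ps m
    using pigment_act_one[OF nth_tuple_pigmented[OF that(2,1)]] by simp
  show "superpose (pigmented_clone G) n n w (map (\<lambda>i. proj (pigmented_clone G) i n) [1..<Suc n]) = w"
    if "w \<in> ops (pigmented_clone G) n" for w n
    using that by (induction w) (auto simp del: upt_Suc)
  show "superpose (pigmented_clone G) m k (superpose (pigmented_clone G) n m w ps) qs =
      superpose (pigmented_clone G) n k w (map (\<lambda>p. superpose (pigmented_clone G) m k p qs) ps)"
    if "w \<in> ops (pigmented_clone G) n" "ps \<in> tuples n (ops (pigmented_clone G) m)"
      "qs \<in> tuples m (ops (pigmented_clone G) k)" for w n ps m qs k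
    using that(1)
  proof (induction w)
    case (Cons l w)
    obtain i \<alpha> where l: "l = (i, \<alpha>)"
      by (cases l)
    then have "i \<in> {1..n}" "\<alpha> \<in> carrier G"
      using Cons.prems by auto
    moreover have "length ps = n"
      using that(2) by (simp add: tuples_def)
    ultimately show ?case
      using l Cons superpose_pigment_act[OF _ nth_tuple_pigmented[OF that(2)] that(3), of \<alpha> i]
      by auto
  qed simp
qed auto

end


section \<open>Evaluation and normal forms of terms\<close>

text \<open>The last equation interprets \<open>U\<close> as the empty word. For \<open>P\<close>
  and \<open>Star\<close> with a wrong number of arguments it is a default value outside the
  signature.\<close>

fun eval_op :: "('m, 'b) monoid_scheme \<Rightarrow> 'm pig_op \<Rightarrow> 'm pword list \<Rightarrow> 'm pword"
  where
    "eval_op M (P \<alpha>) [v] = pigment_act M \<alpha> v"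
  | "eval_op M Star [v, w] = v @ w"
  | "eval_op M _ _ = []"

primrec eval_term :: "('m, 'b) monoid_scheme \<Rightarrow> 'm pig_op trm \<Rightarrow> 'm pword"
  where
    "eval_term M (Var i) = [(i, \<one>\<^bsub>M\<^esub>)]"
  | "eval_term M (Op g ts) = eval_op M g (map (eval_term M) ts)"

text \<open>Every product ends in the unit, even that of a single letter, so that the recursion is
  uniform.\<close>

primrec word_term :: "'m pword \<Rightarrow> 'm pig_op trm"
  where
    "word_term [] = Op U []"
  | "word_term (l # w) = Op Star [Op (P (snd l)) [Var (fst l)], word_term w]"

lemma pig_sig_iff [simp]:
  "U \<in> pig_sig M k \<longleftrightarrow> k = 0"
  "P \<alpha> \<in> pig_sig M k \<longleftrightarrow> k = 1 \<and> \<alpha> \<in> carrier M"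
  "Star \<in> pig_sig M k \<longleftrightarrow> k = 2"
  by (auto simp: pig_sig_def)

text \<open>The signature forces argument lists of length 0, 1 and 2, so structural induction splits
  into one case per kind of symbol.\<close>

lemma pig_term_induct [consumes 1, case_names Var U P Star]:
  assumes "t \<in> ops (term_clone (pig_sig M)) n"
    and "\<And>i. i \<in> {1..n} \<Longrightarrow> Q (Var i)"
    and "Q (Op U [])"
    and "\<And>\<alpha> t. \<alpha> \<in> carrier M \<Longrightarrow> t \<in> ops (term_clone (pig_sig M)) n \<Longrightarrow> Q t \<Longrightarrow>
      Q (Op (P \<alpha>) [t])"
    and "\<And>s t. s \<in> ops (term_clone (pig_sig M)) n \<Longrightarrow> t \<in> ops (term_clone (pig_sig M)) n \<Longrightarrow>
      Q s \<Longrightarrow> Q t \<Longrightarrow> Q (Op Star [s, t])"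
  shows "Q t"
  using assms(1)
proof (induction t)
  case (Var i)
  then show ?case by (simp add: assms(2))
next
  case (Op g ts)
  then have IH: "Q t" if "t \<in> set ts" for t
    using that by auto
  show ?case
  proof (cases g)
    case U
    with Op show ?thesis by (simp add: assms(3))
  next
    case (P \<alpha>)
    with Op obtain t where "ts = [t]"
      by (auto simp: length_Suc_conv)
    with P Op IH show ?thesis by (simp add: assms(4))
  next
    case Star
    with Op obtain s t where "ts = [s, t]"
      by (auto simp: length_Suc_conv numeral_2_eq_2)
    with Star Op IH show ?thesis by (simp add: assms(5))
  qed
qed

lemma word_term_closed:
  "w \<in> ops (pigmented_clone M) n \<Longrightarrow> word_term w \<in> ops (term_clone (pig_sig M)) n"
  by (induction w) auto

context monoid
begin

lemma eval_term_closed: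
  "t \<in> ops (term_clone (pig_sig G)) n \<Longrightarrow> eval_term G t \<in> ops (pigmented_clone G) n"
proof (induction rule: pig_term_induct)
  case (P \<alpha> t)
  then show ?case
    using pigment_act_closed by simp
qed auto

text \<open>Induction on \<open>t\<close>: a variable is the projection law for words,
  \<open>P\<close> is the commutation of pigments with superposition, and \<open>Star\<close> is the
  splitting of superposition over concatenation.\<close>

lemma eval_term_subst:
  assumes "t \<in> ops (term_clone (pig_sig G)) n"
    and us: "us \<in> tuples n (ops (term_clone (pig_sig G)) m)"
  shows "eval_term G (subst us t) =
    superpose (pigmented_clone G) n m (eval_term G t) (map (eval_term G) us)"
proof -
  have ps: "map (eval_term G) us \<in> tuples n (ops (pigmented_clone G) m)"
    using us eval_term_closed by (rule map_in_tuples)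
  show ?thesis
    using assms(1)
  proof (induction rule: pig_term_induct)
    case (Var i)
    then show ?case
      using us clone.proj_superpose[OF clone_pigmented_clone Var ps]
      by (auto simp: tuples_def)
  next
    case (P \<alpha> t)
    then show ?case
      using superpose_pigment_act[OF _ eval_term_closed ps] by simp
  qed auto
qed

lemma clone_morphism_eval_term:
  "clone_morphism (term_clone (pig_sig G)) (pigmented_clone G) (\<lambda>_. eval_term G)"
proof -
  interpret T: clone "term_clone (pig_sig G)"
    by (rule clone_term_clone)
  interpret W: clone "pigmented_clone G"
    by (rule clone_pigmented_clone)
  show ?thesis
    by unfold_locales
      (simp_all add: eval_term_closed eval_term_subst del: in_ops_pigmented_clone)
qed

lemma eval_word_term: "w \<in> ops (pigmented_clone G) n \<Longrightarrow> eval_term G (word_term w) = w"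
  by (induction w) auto

text \<open>\<open>word_term\<close> is a section of evaluation.\<close>

lemma eval_term_surj:
  "eval_term G ` ops (term_clone (pig_sig G)) n = ops (pigmented_clone G) n"
proof
  show "ops (pigmented_clone G) n \<subseteq> eval_term G ` ops (term_clone (pig_sig G)) n"
    using eval_word_term word_term_closed by (metis image_eqI subsetI)
qed (use eval_term_closed in blast)

text \<open>Comparing the sides on bare variables is enough: substitution instances are covered once
  the kernel is a congruence.\<close>

lemma eval_term_pig_axioms: "(s, t) \<in> pig_axioms G \<Longrightarrow> eval_term G s = eval_term G t"
  by (auto elim!: pig_axioms.cases)

lemma pig_rel_subset_kernel:
  "pig_rel G n \<subseteq> clone_kernel (term_clone (pig_sig G)) (\<lambda>_. eval_term G) n"
  unfolding pig_rel_def Let_def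
proof (rule generated_equiv_least)
  show "equiv (ops (term_clone (pig_sig G)) n)
      (clone_kernel (term_clone (pig_sig G)) (\<lambda>_. eval_term G) n)"
    using clone_morphism.clone_congruence_kernel[OF clone_morphism_eval_term]
    by (simp add: clone_congruence_def)
qed (auto simp: clone_kernel_def eval_term_pig_axioms)

end

section \<open>Equational reasoning in an arbitrary congruence containing the axioms\<close>

locale pigmented_congruence = monoid +
  fixes E :: "nat \<Rightarrow> 'a pig_op trm rel"
  assumes congruence: "clone_congruence (term_clone (pig_sig G)) E"
    and contains_rel: "\<And>k. pig_rel G k \<subseteq> E k"
begin

abbreviation T :: "nat \<Rightarrow> 'a pig_op trm set"
  where "T \<equiv> ops (term_clone (pig_sig G))"

lemma E_refl: "t \<in> T n \<Longrightarrow> (t, t) \<in> E n"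
  and E_sym: "(s, t) \<in> E n \<Longrightarrow> (t, s) \<in> E n"
  and E_trans [trans]: "(s, t) \<in> E n \<Longrightarrow> (t, u) \<in> E n \<Longrightarrow> (s, u) \<in> E n"
proof -
  have "equiv (T n) (E n)"
    using congruence by (simp add: clone_congruence_def)
  then show "t \<in> T n \<Longrightarrow> (t, t) \<in> E n" "(s, t) \<in> E n \<Longrightarrow> (t, s) \<in> E n"
    "(s, t) \<in> E n \<Longrightarrow> (t, u) \<in> E n \<Longrightarrow> (s, u) \<in> E n"
    by (blast elim: equivE dest: refl_onD symD transD)+
qed

text \<open>An axiom belongs to \<open>pig_rel\<close> only in arities \<open>k\<close> that
  accommodate its variables. Substitution then moves it to any arity \<open>n\<close>, including
  arities too small for the axiom itself.\<close>

lemma axiom_instance: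
  assumes "(s, t) \<in> pig_axioms G" "s \<in> T k" "t \<in> T k" "us \<in> tuples k (T n)"
  shows "(subst us s, subst us t) \<in> E n"
proof (rule congruence_subst[OF congruence _ assms(4)])
  show "(s, t) \<in> E k"
    using assms(1-3) contains_rel[of k] subset_generated_equiv
    by (fastforce simp: pig_rel_def Let_def)
qed

lemma E_assoc:
  "a \<in> T n \<Longrightarrow> b \<in> T n \<Longrightarrow> c \<in> T n \<Longrightarrow>
    (Op Star [Op Star [a, b], c], Op Star [a, Op Star [b, c]]) \<in> E n"
  \<comment> \<open>The source arity is the number of variables of the axiom, here and in the
    instances below.\<close>
  using axiom_instance[OF pig_axioms.intros(1), of 3 "[a, b, c]" n] by (simp add: tuples_def)

lemma E_left_unit:
  "a \<in> T n \<Longrightarrow> (Op Star [Op U [], a], a) \<in> E n"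
  using axiom_instance[OF pig_axioms.intros(2), of 1 "[a]" n] by (simp add: tuples_def)

lemma E_right_unit:
  "a \<in> T n \<Longrightarrow> (a, Op Star [a, Op U []]) \<in> E n"
  using axiom_instance[OF pig_axioms.intros(3), of 1 "[a]" n] by (simp add: tuples_def)

lemma E_P_Star:
  "\<alpha> \<in> carrier G \<Longrightarrow> a \<in> T n \<Longrightarrow> b \<in> T n \<Longrightarrow>
    (Op (P \<alpha>) [Op Star [a, b]], Op Star [Op (P \<alpha>) [a], Op (P \<alpha>) [b]]) \<in> E n"
  using axiom_instance[OF pig_axioms.intros(4), of \<alpha> 2 "[a, b]" n] by (simp add: tuples_def)

lemma E_P_U:
  "\<alpha> \<in> carrier G \<Longrightarrow> (Op (P \<alpha>) [Op U []], Op U []) \<in> E n"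
  \<comment> \<open>This axiom is closed, so it is taken in arity 0 and moved to arity
    \<open>n\<close> by the empty tuple.\<close>
  using axiom_instance[OF pig_axioms.intros(5), of \<alpha> 0 "[]" n] by (simp add: tuples_def)

lemma E_P_P:
  "\<alpha> \<in> carrier G \<Longrightarrow> \<beta> \<in> carrier G \<Longrightarrow> a \<in> T n \<Longrightarrow>
    (Op (P \<alpha>) [Op (P \<beta>) [a]], Op (P (\<alpha> \<otimes> \<beta>)) [a]) \<in> E n"
  using axiom_instance[OF pig_axioms.intros(6), of \<alpha> \<beta> 1 "[a]" n] by (simp add: tuples_def)

lemma E_P_one:
  "a \<in> T n \<Longrightarrow> (Op (P \<one>) [a], a) \<in> E n"
  using axiom_instance[OF pig_axioms.intros(7), of 1 "[a]" n] by (simp add: tuples_def)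

lemma E_Star:
  "(a, a') \<in> E n \<Longrightarrow> (b, b') \<in> E n \<Longrightarrow> (Op Star [a, b], Op Star [a', b']) \<in> E n"
  by (rule congruence_Op[OF congruence]) auto

lemma E_P: "\<alpha> \<in> carrier G \<Longrightarrow> (a, a') \<in> E n \<Longrightarrow> (Op (P \<alpha>) [a], Op (P \<alpha>) [a']) \<in> E n"
  by (rule congruence_Op[OF congruence]) auto

text \<open>Associativity moves the first letter of \<open>v\<close> out of the product, and the
  left unit law absorbs the final \<open>U\<close> of \<open>word_term v\<close>.\<close>

lemma word_term_append:
  assumes "v \<in> ops (pigmented_clone G) n" "w \<in> ops (pigmented_clone G) n"
  shows "(Op Star [word_term v, word_term w], word_term (v @ w)) \<in> E n"
  using assms(1)
proof (induction v)
  case Nil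
  show ?case
    using assms(2) by (simp add: E_left_unit word_term_closed)
next
  case (Cons l v)
  let ?l = "Op (P (snd l)) [Var (fst l)]"
  have l: "?l \<in> T n" and v: "v \<in> ops (pigmented_clone G) n"
    using Cons.prems by auto
  have "(Op Star [Op Star [?l, word_term v], word_term w],
      Op Star [?l, Op Star [word_term v, word_term w]]) \<in> E n"
    using l v assms(2) by (intro E_assoc word_term_closed)
  also have "(Op Star [?l, Op Star [word_term v, word_term w]],
      Op Star [?l, word_term (v @ w)]) \<in> E n"
    using Cons.IH[OF v] l by (intro E_Star E_refl)
  finally show ?case by simp
qed

text \<open>The pigment distributes over the product, merges with the pigment of each letter it
  meets, and vanishes at the final \<open>U\<close>.\<close>

lemma word_term_act:
  assumes "\<alpha> \<in> carrier G" "w \<in> ops (pigmented_clone G) n"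
  shows "(Op (P \<alpha>) [word_term w], word_term (pigment_act G \<alpha> w)) \<in> E n"
  using assms(2)
proof (induction w)
  case Nil
  show ?case
    using assms(1) by (simp add: E_P_U)
next
  case (Cons l w)
  obtain i \<beta> where l: "l = (i, \<beta>)"
    by (cases l)
  then have i: "Var i \<in> T n" and \<beta>: "\<beta> \<in> carrier G" and w: "w \<in> ops (pigmented_clone G) n"
    using Cons.prems by auto
  have "(Op (P \<alpha>) [Op Star [Op (P \<beta>) [Var i], word_term w]],
      Op Star [Op (P \<alpha>) [Op (P \<beta>) [Var i]], Op (P \<alpha>) [word_term w]]) \<in> E n"
    using assms(1) i \<beta> w by (intro E_P_Star word_term_closed) auto
  also have "(Op Star [Op (P \<alpha>) [Op (P \<beta>) [Var i]], Op (P \<alpha>) [word_term w]],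
      Op Star [Op (P (\<alpha> \<otimes> \<beta>)) [Var i], word_term (pigment_act G \<alpha> w)]) \<in> E n"
    using assms(1) i \<beta> Cons.IH[OF w] by (intro E_Star E_P_P)
  finally show ?case
    using l by simp
qed

text \<open>By induction the arguments of a symbol may be replaced by normal forms;
  \<open>word_term_act\<close> and \<open>word_term_append\<close> then bring the result to normal
  form.\<close>

lemma term_normal_form: "t \<in> T n \<Longrightarrow> (t, word_term (eval_term G t)) \<in> E n"
proof (induction rule: pig_term_induct)
  case (Var i)
  then have i: "Var i \<in> T n"
    by simp
  \<comment> \<open>A variable is not yet a normal form: it first receives the unit pigment and then
    the trailing \<open>U\<close>.\<close>
  then have "(Var i, Op (P \<one>) [Var i]) \<in> E n"
    by (intro E_sym[OF E_P_one])
  also have "(Op (P \<one>) [Var i], Op Star [Op (P \<one>) [Var i], Op U []]) \<in> E n"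
    using i by (intro E_right_unit) simp
  finally show ?case by simp
next
  case U
  show ?case
    by (simp add: E_refl)
next
  case (P \<alpha> t)
  have "(Op (P \<alpha>) [t], Op (P \<alpha>) [word_term (eval_term G t)]) \<in> E n"
    using P by (intro E_P)
  also have "(Op (P \<alpha>) [word_term (eval_term G t)],
      word_term (pigment_act G \<alpha> (eval_term G t))) \<in> E n"
    using P by (intro word_term_act eval_term_closed)
  finally show ?case by simp
next
  case (Star s t)
  have "(Op Star [s, t], Op Star [word_term (eval_term G s), word_term (eval_term G t)]) \<in> E n"
    using Star by (intro E_Star)
  also have "(Op Star [word_term (eval_term G s), word_term (eval_term G t)],
      word_term (eval_term G s @ eval_term G t)) \<in> E n"
    using Star by (intro word_term_append eval_term_closed)
  finally show ?case by simp
qed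

end

theorem theorem3p3p6:
  fixes M :: "('m, 'b) monoid_scheme"
  assumes "monoid M"
  shows "is_presentation (pig_sig M) (pig_rel M) (pigmented_clone M)"
proof -
  interpret monoid M by fact
  let ?C = "term_clone (pig_sig M)"
  have "variety (pig_sig M) (pig_rel M)"
    unfolding variety_def pig_rel_def Let_def by (intro allI equiv_generated_equiv) blast
  moreover have "generated_congruence ?C (pig_rel M) = clone_kernel ?C (\<lambda>_. eval_term M)"
  \<comment> \<open>The normal form map of the criterion is \<open>word_term\<close>, and the given
    congruence is placed in the locale where normal forms were derived.\<close>
  proof (rule kernel_eq_generated_congruence[OF clone_morphism_eval_term pig_rel_subset_kernel])
    fix E n t
    assume "clone_congruence ?C E" "\<And>k. pig_rel M k \<subseteq> E k" and t: "t \<in> ops ?C n"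
    then interpret pigmented_congruence M E
      by unfold_locales
    show "(t, word_term (eval_term M t)) \<in> E n"
      using t by (rule term_normal_form)
  qed
  moreover have "clones_isomorphic (pigmented_clone M)
      (quotient_clone ?C (clone_kernel ?C (\<lambda>_. eval_term M)))"
    using eval_term_surj by (rule clone_morphism.first_isomorphism[OF clone_morphism_eval_term])
  ultimately show ?thesis
    by (simp add: is_presentation_def)
qed

end
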